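(* Let $G$ be an Eulerian digraph. Then $G$ has the natural Riemann--Roch property if and only if $G$ is a bidirected graph, i.e. $\overrightarrow{d}(u,v)=\overrightarrow{d}(v,u)$ for every pair of vertices $u,v$ of $G$.
   Context: A digraph is a finite directed graph, possibly with multiple edges but without loops; all digraphs are assumed weakly connected. $\overrightarrow{d}(u,v)$ is the number of directed edges from $u$ to $v$; $d^-(v)$, $d^+(v)$ are the indegree and outdegree of $v$ (with multiplicity). $G$ is Eulerian if $d^+(v)=d^-(v)$ for every vertex $v$. $\mathbf{d}^+_G\in\mathbb{Z}^{V(G)}$ is the vector with $\mathbf{d}^+_G(v)=d^+(v)$. The Laplacian $L\in\mathbb{Z}^{V(G)\times V(G)}$ is given by $L(u,u)=-d^+(u)$ and $L(u,v)=\overrightarrow{d}(v,u)$ for $u\neq v$. $\deg(x)=\sum_{v\in V(G)} x(v)$; inequalities between vectors are coordinatewise. A chip-distribution is an element $x\in\mathbb{Z}^{V(G)}$ (negative entries allowed). Firing $v$ replaces $x$ by $x+L\mathbf{1}_v$, where $\mathbf{1}_v$ is the characteristic vector of $v$. A vertex $v$ is active with respect to $x$ if $x(v)\geq d^+(v)$, and firing $v$ is legal if $v$ is active before the firing. A legal game is a sequence of distributions each obtained from the previous one by a legal firing; it terminates when it reaches a distribution with no active vertex. $x$ is terminating if every legal game started from $x$ terminates, and non-terminating if every legal game started from $x$ can be continued indefinitely; by a theorem of Björner and Lovász each $x$ is exactly one of these. Define $$\mathrm{dist}(x)=\min\{\deg(y): y\in\mathbb{Z}^{V(G)},\ y\geq\mathbf{0},\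 x+y\text{ is non-terminating}\}.$$ $G$ has the natural Riemann--Roch property if for each $x\in\mathbb{Z}^{V(G)}$, $$\mathrm{dist}(x)-\mathrm{dist}(\mathbf{d}^+_G-x)=\tfrac12|E(G)|-\deg(x).$$ *)

theory Defs
  imports Complex_Main "Graph_Theory.Graph_Theory"
begin

text \<open>
  Multi-digraphs are the records of type \<^typ>\<open>('a, 'b) pre_digraph\<close>; parallel arcs are
  distinct elements of type \<^typ>\<open>'b\<close> with the same tail and head.
  An integer vector indexed by the vertices is a function \<^typ>\<open>'a \<Rightarrow> int\<close>;
  its values outside \<open>verts G\<close> never influence any of the notions below.
\<close>

definition arc_mult :: "('a, 'b) pre_digraph \<Rightarrow> 'a \<Rightarrow> 'a \<Rightarrow> nat" where
  "arc_mult G u v = card {e \<in> arcs G. tail G e = u \<and> head G e = v}"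

definition eulerian :: "('a, 'b) pre_digraph \<Rightarrow> bool" where
  "eulerian G \<longleftrightarrow> (\<forall>v \<in> verts G. out_degree G v = in_degree G v)"

definition bidirected :: "('a, 'b) pre_digraph \<Rightarrow> bool" where
  "bidirected G \<longleftrightarrow> (\<forall>u \<in> verts G. \<forall>v \<in> verts G. arc_mult G u v = arc_mult G v u)"

definition out_degree_vec :: "('a, 'b) pre_digraph \<Rightarrow> 'a \<Rightarrow> int" where
  "out_degree_vec G v = int (out_degree G v)"

text \<open>
  Note the transposition in the off-diagonal entries: column \<open>v\<close> records the effect of firing \<open>v\<close>.
\<close>

definition laplacian :: "('a, 'b) pre_digraph \<Rightarrow> 'a \<Rightarrow> 'a \<Rightarrow> int" where
  "laplacian G u v = (if u = v then - int (out_degree G u) else int (arc_mult G v u))"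

definition laplacian_apply :: "('a, 'b) pre_digraph \<Rightarrow> ('a \<Rightarrow> int) \<Rightarrow> 'a \<Rightarrow> int" where
  "laplacian_apply G z u = (\<Sum>w \<in> verts G. laplacian G u w * z w)"

definition char_vec :: "'a \<Rightarrow> 'a \<Rightarrow> int" where
  "char_vec v w = (if w = v then 1 else 0)"

definition chip_deg :: "('a, 'b) pre_digraph \<Rightarrow> ('a \<Rightarrow> int) \<Rightarrow> int" where
  "chip_deg G x = (\<Sum>v \<in> verts G. x v)"

definition fire :: "('a, 'b) pre_digraph \<Rightarrow> 'a \<Rightarrow> ('a \<Rightarrow> int) \<Rightarrow> ('a \<Rightarrow> int)" where
  "fire G v x = (\<lambda>u. x u + laplacian_apply G (char_vec v) u)"

definition active :: "('a, 'b) pre_digraph \<Rightarrow> ('a \<Rightarrow> int) \<Rightarrow> 'a \<Rightarrow> bool" where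
  "active G x v \<longleftrightarrow> v \<in> verts G \<and> x v \<ge> int (out_degree G v)"

definition legal_step :: "('a, 'b) pre_digraph \<Rightarrow> ('a \<Rightarrow> int) \<Rightarrow> ('a \<Rightarrow> int) \<Rightarrow> bool" where
  "legal_step G x y \<longleftrightarrow> (\<exists>v. active G x v \<and> y = fire G v x)"

text \<open>
  A (finite) legal game from \<open>x\<close> to \<open>y\<close> is a witness of \<open>(legal_step G)\<^sup>*\<^sup>* x y\<close>.
  Every such game has to be extendable to an infinite one.
\<close>

definition non_terminating :: "('a, 'b) pre_digraph \<Rightarrow> ('a \<Rightarrow> int) \<Rightarrow> bool" where
  "non_terminating G x \<longleftrightarrow>
     (\<forall>y. (legal_step G)\<^sup>*\<^sup>* x y \<longrightarrow>
        (\<exists>X :: nat \<Rightarrow> 'a \<Rightarrow> int. X 0 = y \<and> (\<forall>n. legal_step G (X n) (X (Suc n)))))"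

text \<open>
  The minimum is over a nonempty set of nonnegative integers when \<open>G\<close> is finite with at least
  one vertex: a distribution with enough chips always has an active vertex.
\<close>

definition chip_dist :: "('a, 'b) pre_digraph \<Rightarrow> ('a \<Rightarrow> int) \<Rightarrow> int" where
  "chip_dist G x = (LEAST d. \<exists>y :: 'a \<Rightarrow> int. (\<forall>v \<in> verts G. y v \<ge> 0) \<and>
     non_terminating G (\<lambda>v. x v + y v) \<and> d = chip_deg G y)"

definition natural_riemann_roch :: "('a, 'b) pre_digraph \<Rightarrow> bool" where
  "natural_riemann_roch G \<longleftrightarrow>
     (\<forall>x :: 'a \<Rightarrow> int.
        real_of_int (chip_dist G x - chip_dist G (\<lambda>v. out_degree_vec G v - x v))
          = 1 / 2 * real (card (arcs G)) - real_of_int (chip_deg G x))"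

end

theory Submission
  imports Defs
begin

text \<open>
  The proof compares distributions with vertex orders. An order \<open>r\<close> of the vertices gives a
  distribution \<open>a\<^sub>r\<close> (\<open>later_in_degree r\<close>) that puts on each vertex one chip for each arc
  entering it from a later vertex. In a connected Eulerian digraph a distribution \<open>x\<close> is
  non-terminating iff some \<open>x + L z\<close> lies above some \<open>a\<^sub>r\<close>
  (\<open>non_terminating_iff_above_later_in_degree\<close>): in an infinite game every vertex fires
  again and again, and ordering the vertices by their last firing before a late moment yields
  \<open>r\<close>; conversely, nothing equivalent to a distribution above \<open>a\<^sub>r\<close> is stable.

  Hence \<open>dist x\<close> is the minimum, over all orders \<open>r\<close> and all integer vectors \<open>z\<close>, of the
  sum of the positive parts of \<open>c = a\<^sub>r - x - L z\<close>. Reversing \<open>r\<close> turns \<open>a\<^sub>r\<close> into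
  \<open>d\<^sup>+ - a\<^sub>r\<close>, because each in-arc of a vertex comes from either a later or an earlier vertex.
  So replacing \<open>x, r, z\<close> by \<open>d\<^sup>+ - x\<close>, the reverse of \<open>r\<close>, and \<open>- z\<close> replaces \<open>c\<close> by
  \<open>- c\<close>, and the sums of positive parts of \<open>c\<close> and \<open>- c\<close> differ by
  \<open>deg c = deg a\<^sub>r - deg x\<close>. If every order is balanced, that is, \<open>deg a\<^sub>r\<close> is half the
  number of arcs, this is the Riemann--Roch formula.

  Conversely, the formula forces every non-terminating distribution to have degree at least
  half the number of arcs. This applies to \<open>a\<^sub>r\<close> and to its reverse, whose degrees add up to
  the number of arcs, so every order is balanced. Finally, exchanging two neighbours \<open>u, v\<close> in
  an order changes \<open>deg a\<^sub>r\<close> by the difference between the numbers of arcs from \<open>u\<close> to \<open>v\<close>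
  and from \<open>v\<close> to \<open>u\<close>, so balanced orders make \<open>G\<close> bidirected; and in a bidirected graph
  \<open>a\<^sub>r\<close> and its reverse have the same degree, which is then half the number of arcs.
\<close>

section \<open>Arc counts and the Laplacian of an Eulerian digraph\<close>

locale connected_eulerian_digraph = fin_digraph G + loopfree_digraph G
  for G :: "('a, 'b) pre_digraph" +
  assumes weakly_connected: "Digraph_Component.connected G"
    and eulerian: "eulerian G"
begin

abbreviation mult :: "'a \<Rightarrow> 'a \<Rightarrow> int" where
  "mult u v \<equiv> int (arc_mult G u v)"

lemma mult_self [simp]: "arc_mult G v v = 0"
proof -
  have "{e \<in> arcs G. tail G e = v \<and> head G e = v} = {}"
    using no_loops by fastforce
  then show ?thesis by (simp only: arc_mult_def card.empty)
qed

lemma in_degree_eq_sum_mult: "int (in_degree G v) = (\<Sum>w \<in> verts G. mult w v)"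
proof -
  have "in_arcs G v = (\<Union>w \<in> verts G. {e \<in> arcs G. tail G e = w \<and> head G e = v})"
    by (auto simp: in_arcs_def)
  also have "card \<dots> = (\<Sum>w \<in> verts G. arc_mult G w v)"
    unfolding arc_mult_def by (rule card_UN_disjoint) auto
  finally show ?thesis by (simp add: in_degree_def)
qed

lemma out_degree_eq_sum_mult: "int (out_degree G v) = (\<Sum>w \<in> verts G. mult v w)"
proof -
  have "out_arcs G v = (\<Union>w \<in> verts G. {e \<in> arcs G. tail G e = v \<and> head G e = w})"
    by (auto simp: out_arcs_def)
  also have "card \<dots> = (\<Sum>w \<in> verts G. arc_mult G v w)"
    unfolding arc_mult_def by (rule card_UN_disjoint) auto
  finally show ?thesis by (simp add: out_degree_def)
qed

lemma out_degree_eq_sum_mult_in: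
  "v \<in> verts G \<Longrightarrow> int (out_degree G v) = (\<Sum>w \<in> verts G. mult w v)"
  using eulerian in_degree_eq_sum_mult by (simp add: eulerian_def)

lemma card_arcs_eq_sum_out_degree: "int (card (arcs G)) = chip_deg G (out_degree_vec G)"
proof -
  have "arcs G = (\<Union>v \<in> verts G. out_arcs G v)"
    by (auto simp: out_arcs_def)
  also have "card \<dots> = (\<Sum>v \<in> verts G. out_degree G v)"
    unfolding out_degree_def by (rule card_UN_disjoint) auto
  finally show ?thesis by (simp add: chip_deg_def out_degree_vec_def)
qed

text \<open>
  For an Eulerian digraph the diagonal entry of the Laplacian is minus the indegree, so only
  differences of firing counts along in-arcs matter.
\<close>

lemma laplacian_apply_differences:
  assumes "u \<in> verts G"
  shows "laplacian_apply G z u = (\<Sum>w \<in> verts G. mult w u * (z w - z u))"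
proof -
  have "laplacian_apply G z u =
      (\<Sum>w \<in> verts G. mult w u * z w - (if u = w then int (out_degree G u) * z u else 0))"
    unfolding laplacian_apply_def laplacian_def by (intro sum.cong) auto
  also have "\<dots> = (\<Sum>w \<in> verts G. mult w u * z w) - int (out_degree G u) * z u"
    using assms by (simp add: sum_subtractf)
  also have "\<dots> = (\<Sum>w \<in> verts G. mult w u * (z w - z u))"
    unfolding out_degree_eq_sum_mult_in[OF assms]
    by (simp add: sum_subtractf sum_distrib_right right_diff_distrib)
  finally show ?thesis .
qed

lemma laplacian_apply_add:
  "laplacian_apply G (\<lambda>v. y v + z v) u = laplacian_apply G y u + laplacian_apply G z u"
  by (simp add: laplacian_apply_def distrib_left sum.distrib)

lemma laplacian_apply_minus:
  "laplacian_apply G (\<lambda>v. - z v) u = - laplacian_apply G z u"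
  by (simp add: laplacian_apply_def sum_negf)

lemma laplacian_apply_zero [simp]: "laplacian_apply G (\<lambda>v. 0) u = 0"
  by (simp add: laplacian_apply_def)

lemma laplacian_apply_char_vec:
  assumes "v \<in> verts G"
  shows "laplacian_apply G (char_vec v) u = laplacian G u v"
proof -
  have "laplacian_apply G (char_vec v) u = (\<Sum>w \<in> verts G. if w = v then laplacian G u w else 0)"
    unfolding laplacian_apply_def char_vec_def by (intro sum.cong) auto
  then show ?thesis using assms by simp
qed

lemma chip_deg_laplacian_apply: "chip_deg G (laplacian_apply G z) = 0"
proof -
  have "chip_deg G (laplacian_apply G z) =
      (\<Sum>u \<in> verts G. (\<Sum>w \<in> verts G. mult w u * z w) - z u * (\<Sum>w \<in> verts G. mult w u))"
    unfolding chip_deg_def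
    by (intro sum.cong)
      (simp_all add: laplacian_apply_differences algebra_simps sum_subtractf sum_distrib_left)
  also have "\<dots> = (\<Sum>u \<in> verts G. \<Sum>w \<in> verts G. mult w u * z w)
      - (\<Sum>u \<in> verts G. z u * int (out_degree G u))"
    by (simp add: sum_subtractf out_degree_eq_sum_mult_in)
  also have "(\<Sum>u \<in> verts G. \<Sum>w \<in> verts G. mult w u * z w) =
      (\<Sum>w \<in> verts G. z w * int (out_degree G w))"
    by (subst sum.swap) (simp add: out_degree_eq_sum_mult sum_distrib_left mult.commute)
  finally show ?thesis by simp
qed

lemma chip_deg_add_laplacian:
  "chip_deg G (\<lambda>v. x v + laplacian_apply G z v) = chip_deg G x"
  using chip_deg_laplacian_apply[of z] by (simp add: chip_deg_def sum.distrib)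

text \<open>
  In an Eulerian digraph as many arcs enter a vertex set as leave it. A set that no arc leaves
  is therefore not entered by any arc either, and weak connectivity makes it everything.
\<close>

lemma out_closed_set_eq_verts:
  assumes sub: "S \<subseteq> verts G" and ne: "S \<noteq> {}"
    and closed: "\<And>u v. u \<in> S \<Longrightarrow> v \<in> verts G \<Longrightarrow> arc_mult G u v > 0 \<Longrightarrow> v \<in> S"
  shows "S = verts G"
proof -
  have finS: "finite S" by (rule finite_subset[OF sub finite_verts])
  have split: "sum g (verts G) = sum g S + sum g (verts G - S)" for g :: "'a \<Rightarrow> int"
    using sum.subset_diff[OF sub finite_verts, of g] by simp
  have out0: "(\<Sum>w \<in> verts G - S. mult v w) = 0" if "v \<in> S" for v
    using closed[OF that] by (intro sum.neutral) auto
  have "(\<Sum>v \<in> S. \<Sum>w \<in> verts G. mult v w) = (\<Sum>v \<in> S. \<Sum>w \<in> verts G. mult w v)"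
  proof (rule sum.cong[OF refl])
    fix v
    assume "v \<in> S"
    then have "v \<in> verts G" using sub by blast
    from out_degree_eq_sum_mult[of v] out_degree_eq_sum_mult_in[OF this]
    show "(\<Sum>w \<in> verts G. mult v w) = (\<Sum>w \<in> verts G. mult w v)" by simp
  qed
  then have "(\<Sum>v \<in> S. \<Sum>w \<in> S. mult v w)
      = (\<Sum>v \<in> S. \<Sum>w \<in> S. mult w v) + (\<Sum>v \<in> S. \<Sum>w \<in> verts G - S. mult w v)"
    unfolding split by (simp add: sum.distrib out0)
  moreover have "(\<Sum>v \<in> S. \<Sum>w \<in> S. mult v w) = (\<Sum>v \<in> S. \<Sum>w \<in> S. mult w v)"
    by (rule sum.swap)
  ultimately have "(\<Sum>v \<in> S. \<Sum>w \<in> verts G - S. mult w v) = 0" by simp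
  then have in0: "mult w v = 0" if "v \<in> S" "w \<in> verts G - S" for v w
    using that finS by (simp add: sum_nonneg_eq_0_iff sum_nonneg)
  have arc_pos: "arc_mult G (tail G e) (head G e) > 0" if "e \<in> arcs G" for e
    using that by (auto simp: arc_mult_def card_gt_0_iff)
  have step_sym: "v \<in> S" if "u \<in> S" "(u, v) \<in> parcs (mk_symmetric G)" for u v
  proof -
    from that(2) obtain e where e: "e \<in> arcs G"
      and "(u = tail G e \<and> v = head G e) \<or> (u = head G e \<and> v = tail G e)"
      by (auto simp: mk_symmetric_def)
    then show ?thesis
    proof (elim disjE conjE)
      assume "u = tail G e" "v = head G e"
      then show ?thesis
        using closed[of u v] that(1) arc_pos[OF e] head_in_verts[OF e] by simp
    next
      assume "u = head G e" "v = tail G e"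
      then show ?thesis
        using in0[of u v] that(1) arc_pos[OF e] tail_in_verts[OF e] by fastforce
    qed
  qed
  obtain s where s: "s \<in> S" using ne by blast
  have "v \<in> S" if v: "v \<in> verts G" for v
  proof -
    have "(s, v) \<in> rtrancl_on (verts G) (parcs (mk_symmetric G))"
      using weakly_connected s sub v
      by (auto simp: connected_def strongly_connected_def reachable_def)
    then show ?thesis
    proof (induction rule: rtrancl_on_induct)
      case base
      show ?case by (rule s)
    next
      case (step y z)
      show ?case by (rule step_sym[OF step.IH step.hyps(2)])
    qed
  qed
  then show ?thesis using sub by blast
qed

end

section \<open>Vertex orders and non-terminating distributions\<close>

context connected_eulerian_digraph
begin

text \<open>
  A vertex order is given by ranks \<open>r\<close> that are injective on the vertices. The ranks are integers
  so that the reverse order is simply \<open>- r\<close>.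
\<close>

definition later_in_degree :: "('a \<Rightarrow> int) \<Rightarrow> 'a \<Rightarrow> int" where
  "later_in_degree r v = (\<Sum>w \<in> verts G. if r v < r w then mult w v else 0)"

lemma later_in_degree_reverse:
  assumes "inj_on r (verts G)" and v: "v \<in> verts G"
  shows "later_in_degree r v + later_in_degree (\<lambda>w. - r w) v = out_degree_vec G v"
proof -
  have "(if r v < r w then mult w v else 0) + (if - r v < - r w then mult w v else 0) = mult w v"
    if "w \<in> verts G" for w
    using assms that by (cases "w = v") (auto simp: inj_on_def not_less dest: order.antisym)
  then show ?thesis
    unfolding later_in_degree_def out_degree_vec_def out_degree_eq_sum_mult_in[OF v]
      sum.distrib[symmetric]
    by (intro sum.cong refl)
qed

text \<open>
  Among the vertices minimizing \<open>z\<close>, the first one in the order is active. It holds one chip for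
  each in-arc from a later vertex, and every earlier vertex has a strictly larger value of \<open>z\<close>,
  so \<open>L z\<close> supplies at least one chip for each in-arc from there as well.
\<close>

lemma active_above_later_in_degree:
  assumes ge: "\<And>v. v \<in> verts G \<Longrightarrow> x v \<ge> later_in_degree r v + laplacian_apply G z v"
    and inj: "inj_on r (verts G)"
  shows "\<exists>v. active G x v"
proof -
  have ne: "verts G \<noteq> {}"
    using weakly_connected by (auto simp: connected_def strongly_connected_def)
  define M where "M = {v \<in> verts G. z v = Min (z ` verts G)}"
  have Mfin: "finite M" by (simp add: M_def)
  have "Min (z ` verts G) \<in> z ` verts G" using ne by (intro Min_in) auto
  then have Mne: "M \<noteq> {}" by (auto simp: M_def)
  obtain v where vM: "v \<in> M" and vmin: "\<And>w. w \<in> M \<Longrightarrow> r v \<le> r w"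
    using arg_min_if_finite[OF Mfin Mne, of r] by (metis not_le)
  have v: "v \<in> verts G" using vM by (simp add: M_def)
  have zmin: "z v \<le> z w" if "w \<in> verts G" for w
    using vM that by (simp add: M_def)
  have "mult w v \<le> (if r v < r w then mult w v else 0) + mult w v * (z w - z v)"
    if w: "w \<in> verts G" for w
  proof (cases "w = v \<or> r v < r w")
    case True
    then show ?thesis using zmin[OF w] by auto
  next
    case False
    then have "r w < r v" using inj v w by (auto simp: inj_on_def not_less order.order_iff_strict)
    then have "w \<notin> M" using vmin by fastforce
    then have "z w \<noteq> z v" using w vM by (simp add: M_def)
    then have "1 \<le> z w - z v" using zmin[OF w] by simp
    then have "mult w v * 1 \<le> mult w v * (z w - z v)" by (intro mult_left_mono) auto
    then show ?thesis by simp
  qed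
  then have "(\<Sum>w \<in> verts G. mult w v) \<le> later_in_degree r v + laplacian_apply G z v"
    unfolding later_in_degree_def laplacian_apply_differences[OF v]
    by (simp flip: sum.distrib add: sum_mono)
  also have "\<dots> \<le> x v" by (rule ge[OF v])
  finally show ?thesis using v by (auto simp: active_def out_degree_eq_sum_mult_in)
qed

lemma legal_game_laplacian:
  assumes "(legal_step G)\<^sup>*\<^sup>* x y"
  shows "\<exists>z. \<forall>u. y u = x u + laplacian_apply G z u"
  using assms
proof (induction rule: rtranclp_induct)
  case base
  show ?case by (intro exI[of _ "\<lambda>v. 0"]) simp
next
  case (step y y')
  from step.IH obtain z where z: "\<And>u. y u = x u + laplacian_apply G z u" by blast
  from step.hyps obtain v where "y' = fire G v y" by (auto simp: legal_step_def)
  then have "y' u = x u + laplacian_apply G (\<lambda>w. z w + char_vec v w) u" for u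
    by (simp add: fire_def z laplacian_apply_add)
  then show ?case by blast
qed

lemma non_terminating_above_later_in_degree:
  assumes ge: "\<And>v. v \<in> verts G \<Longrightarrow> x v + laplacian_apply G z v \<ge> later_in_degree r v"
    and inj: "inj_on r (verts G)"
  shows "non_terminating G x"
  unfolding non_terminating_def
proof (intro allI impI)
  fix y
  assume xy: "(legal_step G)\<^sup>*\<^sup>* x y"
  have cont: "\<exists>y''. legal_step G y' y''" if reach: "(legal_step G)\<^sup>*\<^sup>* x y'" for y'
  proof -
    obtain z' where z': "\<And>u. y' u = x u + laplacian_apply G z' u"
      using legal_game_laplacian[OF reach] by blast
    have "later_in_degree r v + laplacian_apply G (\<lambda>w. z' w + (- z w)) v \<le> y' v"
      if "v \<in> verts G" for v
      using ge[OF that] by (simp add: z' laplacian_apply_add[of z'] laplacian_apply_minus del: add_uminus_conv_diff)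
    then show ?thesis
      using active_above_later_in_degree[OF _ inj, of "\<lambda>w. z' w + (- z w)" y']
      by (auto simp: legal_step_def)
  qed
  have "\<exists>X. X 0 = y \<and> (\<forall>n. (legal_step G)\<^sup>*\<^sup>* x (X n) \<and> legal_step G (X n) (X (Suc n)))"
  proof -
    obtain next_state where nx:
      "\<And>y'. (legal_step G)\<^sup>*\<^sup>* x y' \<Longrightarrow> legal_step G y' (next_state y')"
      using cont by metis
    define X where "X n = (next_state ^^ n) y" for n
    have reach: "(legal_step G)\<^sup>*\<^sup>* x (X n)" for n
      by (induction n) (auto simp: X_def xy intro: rtranclp.rtrancl_into_rtrancl nx)
    have "legal_step G (X n) (X (Suc n))" for n
      using nx[OF reach[of n]] by (simp add: X_def)
    then show ?thesis using reach by (intro exI[of _ X]) (simp add: X_def)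
  qed
  then show "\<exists>X. X 0 = y \<and> (\<forall>n. legal_step G (X n) (X (Suc n)))" by blast
qed

text \<open>
  Stop an infinite game when every vertex has fired, and order the vertices by their last firing.
  A vertex has a nonnegative number of chips right after its last firing, and since then
  it has received a chip along each in-arc from a vertex that fired later; so the final
  distribution lies above the one given by this order. Every vertex does fire: the chips on each
  vertex stay bounded, so the out-neighbours of a vertex that fires infinitely often must
  fire infinitely often too, and no nonempty proper vertex set contains all its out-neighbours.
\<close>

lemma infinite_legal_game_above_later_in_degree:
  assumes run: "\<And>n. legal_step G (X n) (X (Suc n))"
  shows "\<exists>r z. inj_on r (verts G) \<and>
    (\<forall>v \<in> verts G. X 0 v + laplacian_apply G z v \<ge> later_in_degree r v)"
proof -
  obtain f where act: "\<And>n. active G (X n) (f n)" and fire: "\<And>n. X (Suc n) = fire G (f n) (X n)"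
    using run unfolding legal_step_def by metis
  have fV: "f n \<in> verts G" for n using act by (simp add: active_def)
  have step_fired: "X (Suc n) (f n) \<ge> 0" for n
    using act[of n] by (simp add: fire fire_def laplacian_apply_char_vec fV laplacian_def active_def)
  have step_other: "X (Suc n) u = X n u + mult (f n) u" if "u \<noteq> f n" for n u
    using that by (simp add: fire fire_def laplacian_apply_char_vec fV laplacian_def)
  have lower: "X n u \<ge> min 0 (X 0 u)" for n u
  proof (induction n)
    case (Suc n)
    then show ?case using step_fired[of n] step_other[of u n] by (cases "u = f n") auto
  qed simp
  have deg: "chip_deg G (X n) = chip_deg G (X 0)" for n
    by (induction n) (simp_all add: fire fire_def chip_deg_add_laplacian)
  \<comment> \<open>The total number of chips is constant and no vertex falls below a fixed bound, so no vertex
    can rise above \<open>B\<close>.\<close>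
  define B where "B v = chip_deg G (X 0) - (\<Sum>w \<in> verts G - {v}. min 0 (X 0 w))" for v
  have upper: "X n v \<le> B v" if "v \<in> verts G" for n v
  proof -
    have "chip_deg G (X 0) = X n v + (\<Sum>w \<in> verts G - {v}. X n w)"
      using that deg[of n] by (simp add: chip_deg_def sum.remove)
    moreover have "(\<Sum>w \<in> verts G - {v}. min 0 (X 0 w)) \<le> (\<Sum>w \<in> verts G - {v}. X n w)"
      by (intro sum_mono lower)
    ultimately show ?thesis by (simp add: B_def)
  qed
  have growth: "X t v = X s v + (\<Sum>i = s..<t. mult (f i) v)"
    if "s \<le> t" "\<And>i. s \<le> i \<Longrightarrow> i < t \<Longrightarrow> f i \<noteq> v" for s t v
    using that
  proof (induction t rule: dec_induct)
    case (step t)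
    then show ?case using step_other[of v t] by (auto simp: less_Suc_eq add.assoc)
  qed simp
  define S where "S = {v \<in> verts G. infinite {n. f n = v}}"
  have "S \<noteq> {}"
  proof
    assume "S = {}"
    then have "finite (\<Union>v \<in> verts G. {n. f n = v})" by (auto simp: S_def)
    moreover have "(\<Union>v \<in> verts G. {n. f n = v}) = UNIV" using fV by auto
    ultimately show False by simp
  qed
  moreover have "v \<in> S" if w: "w \<in> S" and v: "v \<in> verts G" and pos: "arc_mult G w v > 0" for w v
  proof (rule ccontr)
    assume "v \<notin> S"
    then have "finite {n. f n = v}" using v by (simp add: S_def)
    then obtain N where N: "\<And>n. f n = v \<Longrightarrow> n < N"
      unfolding finite_nat_set_iff_bounded by blast
    \<comment> \<open>After \<open>N\<close> the vertex \<open>v\<close> only gains chips; \<open>F\<close> collects enough later firings of \<open>w\<close>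
      to exceed the bound on \<open>v\<close>.\<close>
    have "infinite ({n. f n = w} - {..<N})" using w by (simp add: S_def)
    then obtain F where F: "finite F" "F \<subseteq> {n. f n = w} - {..<N}"
      "card F = nat (B v - X N v) + 1"
      by (meson infinite_arbitrarily_large)
    define t where "t = Suc (Max (insert N F))"
    have "N \<le> Max (insert N F)" using F(1) by (intro Max_ge) auto
    then have "N \<le> t" unfolding t_def by (rule le_SucI)
    then have Ft: "F \<subseteq> {N..<t}" "N \<le> t"
      using F(1,2) by (auto simp: t_def less_Suc_eq_le)
    have "int (card F) = (\<Sum>i \<in> F. 1)" by simp
    also have "\<dots> \<le> (\<Sum>i \<in> F. mult (f i) v)"
      using F(2) pos by (intro sum_mono) auto
    also have "\<dots> \<le> (\<Sum>i = N..<t. mult (f i) v)"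
      using Ft by (intro sum_mono2) auto
    also have "\<dots> = X t v - X N v"
      using growth[OF Ft(2), of v] N by fastforce
    also have "\<dots> \<le> B v - X N v" using upper[OF v] by simp
    finally show False using F(3) by (simp split: if_splits)
  qed
  ultimately have S: "S = verts G"
    by (intro out_closed_set_eq_verts) (auto simp: S_def)
  have "\<exists>n. f n = v" if "v \<in> verts G" for v
    using that S not_finite_existsD by (fastforce simp: S_def)
  then obtain t0 where t0: "\<And>v. v \<in> verts G \<Longrightarrow> f (t0 v) = v" by metis
  define T where "T = Suc (Max (t0 ` verts G))"
  have t0T: "t0 v < T" if "v \<in> verts G" for v
    using that by (simp add: T_def less_Suc_eq_le)
  define last_firing where "last_firing v = Max {t. t < T \<and> f t = v}" for v
  have last_in: "last_firing v < T \<and> f (last_firing v) = v" if "v \<in> verts G" for v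
  proof -
    have "last_firing v \<in> {t. t < T \<and> f t = v}"
      unfolding last_firing_def using t0 t0T that by (intro Max_in) auto
    then show ?thesis by simp
  qed
  have last_max: "t \<le> last_firing v" if "t < T" "f t = v" for t v
    unfolding last_firing_def using that by (intro Max_ge) auto
  have inj: "inj_on last_firing (verts G)"
    by (rule inj_on_inverseI[of _ f]) (use last_in in blast)
  define r where "r v = int (last_firing v)" for v
  have dominates: "later_in_degree r v \<le> X T v" if v: "v \<in> verts G" for v
  proof -
    let ?W = "{w \<in> verts G. last_firing v < last_firing w}"
    let ?s = "Suc (last_firing v)"
    have "later_in_degree r v = (\<Sum>w \<in> ?W. mult w v)"
      unfolding later_in_degree_def r_def by (simp add: sum.inter_filter)
    also have "\<dots> = (\<Sum>w \<in> ?W. mult (f (last_firing w)) v)"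
      using last_in by (intro sum.cong) auto
    also have "\<dots> = (\<Sum>i \<in> last_firing ` ?W. mult (f i) v)"
      using inj by (subst sum.reindex) (auto intro: inj_on_subset)
    also have "\<dots> \<le> (\<Sum>i = ?s..<T. mult (f i) v)"
      using last_in by (intro sum_mono2) auto
    also have "\<dots> \<le> X ?s v + (\<Sum>i = ?s..<T. mult (f i) v)"
      using step_fired[of "last_firing v"] last_in[OF v] by simp
    also have "\<dots> = X T v"
      using last_in[OF v] last_max[of _ v]
      by (intro growth[symmetric]) (auto simp: Suc_le_eq not_le[symmetric])
    finally show ?thesis .
  qed
  have "(legal_step G)\<^sup>*\<^sup>* (X 0) (X n)" for n
    by (induction n) (auto intro: rtranclp.rtrancl_into_rtrancl run)
  then obtain z where "\<And>u. X T u = X 0 u + laplacian_apply G z u"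
    using legal_game_laplacian by blast
  moreover have "inj_on r (verts G)"
    using inj by (simp add: r_def inj_on_def)
  ultimately show ?thesis using dominates by (intro exI[of _ r] exI[of _ z]) auto
qed

theorem non_terminating_iff_above_later_in_degree:
  "non_terminating G x \<longleftrightarrow> (\<exists>r z. inj_on r (verts G) \<and>
    (\<forall>v \<in> verts G. x v + laplacian_apply G z v \<ge> later_in_degree r v))"
proof
  assume "non_terminating G x"
  then obtain X where "X 0 = x" "\<And>n. legal_step G (X n) (X (Suc n))"
    unfolding non_terminating_def by blast
  then show "\<exists>r z. inj_on r (verts G) \<and>
    (\<forall>v \<in> verts G. x v + laplacian_apply G z v \<ge> later_in_degree r v)"
    using infinite_legal_game_above_later_in_degree[of X] by simp
qed (blast intro: non_terminating_above_later_in_degree)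

section \<open>The distance to non-terminating distributions\<close>

text \<open>
  The integers are not well-ordered, so boundedness from below has to be supplied for the least
  element in the definition of \<open>chip_dist\<close> to exist.
\<close>

lemma Least_int_bounded_below:
  fixes P :: "int \<Rightarrow> bool"
  assumes nonneg: "\<And>d. P d \<Longrightarrow> 0 \<le> d" and ex: "P d0"
  shows "P (LEAST d. P d)" and "\<And>d. P d \<Longrightarrow> (LEAST d. P d) \<le> d"
proof -
  define n where "n = (LEAST k. P (int k))"
  have "P (int (nat d0))" using nonneg[OF ex] ex by simp
  then have n: "P (int n)" unfolding n_def by (rule LeastI)
  have le: "int n \<le> d" if "P d" for d
  proof -
    have "P (int (nat d))" using nonneg[OF that] that by simp
    then have "n \<le> nat d" unfolding n_def by (rule Least_le)
    then show ?thesis using nonneg[OF that] by linarith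
  qed
  have "(LEAST d. P d) = int n" by (rule Least_equality) (use n le in auto)
  then show "P (LEAST d. P d)" and "\<And>d. P d \<Longrightarrow> (LEAST d. P d) \<le> d"
    using n le by simp_all
qed

text \<open>
  The positive part of this vector is the least number of chips to add to \<open>x\<close> so that, after
  firing according to \<open>z\<close>, the result lies above the distribution of the order \<open>r\<close>.
\<close>

definition shortfall :: "('a \<Rightarrow> int) \<Rightarrow> ('a \<Rightarrow> int) \<Rightarrow> ('a \<Rightarrow> int) \<Rightarrow> 'a \<Rightarrow> int" where
  "shortfall x r z v = later_in_degree r v - x v - laplacian_apply G z v"

lemma ex_vertex_order: "\<exists>r :: 'a \<Rightarrow> int. inj_on r (verts G)"
proof -
  obtain f :: "'a \<Rightarrow> nat" where "inj_on f (verts G)"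
    using finite_imp_inj_to_nat_seg[OF finite_verts] by blast
  then have "inj_on (\<lambda>v. int (f v)) (verts G)" by (simp add: inj_on_def)
  then show ?thesis by blast
qed

lemma non_terminating_add_shortfall:
  assumes "inj_on r (verts G)"
  shows "non_terminating G (\<lambda>v. x v + max 0 (shortfall x r z v))"
  using assms
  by (intro non_terminating_above_later_in_degree[of r _ z]) (auto simp: shortfall_def)

lemma chip_dist_cases:
  shows chip_dist_attained: "\<exists>y. (\<forall>v \<in> verts G. y v \<ge> 0) \<and>
      non_terminating G (\<lambda>v. x v + y v) \<and> chip_dist G x = chip_deg G y"
    and chip_dist_le: "(\<And>v. v \<in> verts G \<Longrightarrow> y v \<ge> 0) \<Longrightarrow>
      non_terminating G (\<lambda>v. x v + y v) \<Longrightarrow> chip_dist G x \<le> chip_deg G y"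
proof -
  let ?P = "\<lambda>d. \<exists>y :: 'a \<Rightarrow> int. (\<forall>v \<in> verts G. y v \<ge> 0) \<and>
     non_terminating G (\<lambda>v. x v + y v) \<and> d = chip_deg G y"
  obtain r :: "'a \<Rightarrow> int" where r: "inj_on r (verts G)" using ex_vertex_order by blast
  have ex: "?P (chip_deg G (\<lambda>v. max 0 (shortfall x r (\<lambda>v. 0) v)))"
    by (intro exI[of _ "\<lambda>v. max 0 (shortfall x r (\<lambda>v. 0) v)"])
      (simp add: non_terminating_add_shortfall r)
  have nonneg: "0 \<le> d" if "?P d" for d
    using that by (auto simp: chip_deg_def intro: sum_nonneg)
  show "\<exists>y. (\<forall>v \<in> verts G. y v \<ge> 0) \<and>
      non_terminating G (\<lambda>v. x v + y v) \<and> chip_dist G x = chip_deg G y"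
    unfolding chip_dist_def by (rule Least_int_bounded_below(1)[where P = ?P, OF nonneg ex])
  show "chip_dist G x \<le> chip_deg G y"
    if "\<And>v. v \<in> verts G \<Longrightarrow> y v \<ge> 0" "non_terminating G (\<lambda>v. x v + y v)"
    unfolding chip_dist_def
    by (rule Least_int_bounded_below(2)[where P = ?P, OF nonneg ex]) (use that in auto)
qed

lemma chip_dist_le_shortfall:
  assumes "inj_on r (verts G)"
  shows "chip_dist G x \<le> chip_deg G (\<lambda>v. max 0 (shortfall x r z v))"
  by (rule chip_dist_le) (auto intro: non_terminating_add_shortfall assms)

text \<open>
  An optimal \<open>y\<close> makes \<open>x + y\<close> non-terminating, hence lies above the positive part of
  some shortfall, which already suffices and so cannot have smaller degree than \<open>y\<close>.
\<close>

lemma chip_dist_eq_shortfall: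
  "\<exists>r z. inj_on r (verts G) \<and> chip_dist G x = chip_deg G (\<lambda>v. max 0 (shortfall x r z v))"
proof -
  obtain y where y: "\<And>v. v \<in> verts G \<Longrightarrow> y v \<ge> 0" "non_terminating G (\<lambda>v. x v + y v)"
    "chip_dist G x = chip_deg G y"
    using chip_dist_attained[of x] by blast
  from y(2) obtain r z where r: "inj_on r (verts G)"
    and ge: "\<And>v. v \<in> verts G \<Longrightarrow> x v + y v + laplacian_apply G z v \<ge> later_in_degree r v"
    unfolding non_terminating_iff_above_later_in_degree by blast
  have "max 0 (shortfall x r z v) \<le> y v" if "v \<in> verts G" for v
    using ge[OF that] y(1)[OF that] by (simp add: shortfall_def)
  then have "chip_deg G (\<lambda>v. max 0 (shortfall x r z v)) \<le> chip_dist G x"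
    unfolding y(3) chip_deg_def by (rule sum_mono)
  then show ?thesis using r chip_dist_le_shortfall[OF r, of x z] by (metis order.antisym)
qed

lemma chip_dist_nonneg: "chip_dist G x \<ge> 0"
  using chip_dist_attained[of x] by (auto simp: chip_deg_def sum_nonneg)

lemma chip_dist_eq_0:
  assumes "non_terminating G x"
  shows "chip_dist G x = 0"
  using chip_dist_le[of "\<lambda>v. 0" x] assms chip_dist_nonneg[of x]
  by (simp add: chip_deg_def)

section \<open>Riemann--Roch forces and follows from balanced orders\<close>

lemma chip_deg_later_in_degree_reverse:
  assumes "inj_on r (verts G)"
  shows "chip_deg G (later_in_degree r) + chip_deg G (later_in_degree (\<lambda>w. - r w))
    = int (card (arcs G))"
  unfolding card_arcs_eq_sum_out_degree chip_deg_def sum.distrib[symmetric]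
  by (intro sum.cong refl later_in_degree_reverse assms)

text \<open>
  Take an optimal order and firing vector for \<open>x\<close>; the reverse order and the negated firing
  vector are admissible for \<open>d\<^sup>+ - x\<close> and have the negated shortfall. Since the passage from
  \<open>x\<close> to \<open>d\<^sup>+ - x\<close> is an involution, applying this inequality to both yields an equation.
\<close>

lemma chip_dist_dual_le:
  assumes balanced: "\<And>r. inj_on r (verts G) \<Longrightarrow>
      2 * chip_deg G (later_in_degree r) = int (card (arcs G))"
  shows "2 * chip_dist G (\<lambda>v. out_degree_vec G v - x v)
    \<le> 2 * chip_dist G x - int (card (arcs G)) + 2 * chip_deg G x"
proof -
  obtain r z where r: "inj_on r (verts G)"
    and dist: "chip_dist G x = chip_deg G (\<lambda>v. max 0 (shortfall x r z v))"
    using chip_dist_eq_shortfall by blast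
  let ?r = "\<lambda>v. - r v" and ?z = "\<lambda>v. - z v" and ?x = "\<lambda>v. out_degree_vec G v - x v"
  have neg: "shortfall ?x ?r ?z v = - shortfall x r z v" if "v \<in> verts G" for v
    using later_in_degree_reverse[OF r that]
    by (simp add: shortfall_def laplacian_apply_minus)
  have "inj_on ?r (verts G)" using r by (simp add: inj_on_def)
  then have "chip_dist G ?x \<le> chip_deg G (\<lambda>v. max 0 (shortfall ?x ?r ?z v))"
    by (rule chip_dist_le_shortfall)
  also have "\<dots> = chip_deg G (\<lambda>v. max 0 (shortfall x r z v) - shortfall x r z v)"
    unfolding chip_deg_def by (intro sum.cong) (auto simp: neg max_def)
  also have "\<dots> = chip_dist G x - chip_deg G (shortfall x r z)"
    by (simp add: dist chip_deg_def sum_subtractf)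
  also have "chip_deg G (shortfall x r z) = chip_deg G (later_in_degree r) - chip_deg G x"
    using chip_deg_laplacian_apply[of z]
    by (simp add: shortfall_def chip_deg_def sum_subtractf)
  finally show ?thesis using balanced[OF r] by simp
qed

lemma natural_riemann_roch_iff_int:
  "natural_riemann_roch G \<longleftrightarrow>
    (\<forall>x. 2 * (chip_dist G x - chip_dist G (\<lambda>v. out_degree_vec G v - x v))
      = int (card (arcs G)) - 2 * chip_deg G x)"
proof -
  have eq: "real_of_int a = 1 / 2 * real m - real_of_int d \<longleftrightarrow> 2 * a = int m - 2 * d" for a m d
  proof -
    have "real_of_int a = 1 / 2 * real m - real_of_int d
        \<longleftrightarrow> real_of_int (2 * a) = real_of_int (int m - 2 * d)"
      by auto
    then show ?thesis unfolding of_int_eq_iff .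
  qed
  show ?thesis unfolding natural_riemann_roch_def eq ..
qed

text \<open>
  For the forward direction, \<open>dist\<close> vanishes at the non-terminating distribution of an order and
  is nonnegative at its dual, so the formula bounds the degree of every order from below; reversing
  the order gives the upper bound.
\<close>

theorem natural_riemann_roch_iff_balanced:
  "natural_riemann_roch G \<longleftrightarrow>
    (\<forall>r. inj_on r (verts G) \<longrightarrow> 2 * chip_deg G (later_in_degree r) = int (card (arcs G)))"
proof
  assume rr: "natural_riemann_roch G"
  have ge: "int (card (arcs G)) \<le> 2 * chip_deg G (later_in_degree r)"
    if "inj_on r (verts G)" for r
  proof -
    have "non_terminating G (later_in_degree r)"
      using that by (intro non_terminating_above_later_in_degree[of r _ "\<lambda>v. 0"]) auto
    then have "chip_dist G (later_in_degree r) = 0" by (rule chip_dist_eq_0)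
    moreover have "2 * (chip_dist G (later_in_degree r)
        - chip_dist G (\<lambda>v. out_degree_vec G v - later_in_degree r v))
      = int (card (arcs G)) - 2 * chip_deg G (later_in_degree r)"
      using rr unfolding natural_riemann_roch_iff_int by blast
    ultimately show ?thesis
      using chip_dist_nonneg[of "\<lambda>v. out_degree_vec G v - later_in_degree r v"] by simp
  qed
  show "\<forall>r. inj_on r (verts G) \<longrightarrow> 2 * chip_deg G (later_in_degree r) = int (card (arcs G))"
  proof (intro allI impI)
    fix r :: "'a \<Rightarrow> int"
    assume r: "inj_on r (verts G)"
    then have "inj_on (\<lambda>v. - r v) (verts G)" by (simp add: inj_on_def)
    from ge[OF this] ge[OF r] chip_deg_later_in_degree_reverse[OF r]
    show "2 * chip_deg G (later_in_degree r) = int (card (arcs G))" by linarith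
  qed
next
  assume "\<forall>r. inj_on r (verts G) \<longrightarrow> 2 * chip_deg G (later_in_degree r) = int (card (arcs G))"
  then have le: "2 * chip_dist G (\<lambda>v. out_degree_vec G v - x v)
    \<le> 2 * chip_dist G x - int (card (arcs G)) + 2 * chip_deg G x" for x
    using chip_dist_dual_le by blast
  show "natural_riemann_roch G"
    unfolding natural_riemann_roch_iff_int
  proof
    fix x :: "'a \<Rightarrow> int"
    have "chip_deg G (\<lambda>v. out_degree_vec G v - x v) = int (card (arcs G)) - chip_deg G x"
      unfolding card_arcs_eq_sum_out_degree by (simp add: chip_deg_def sum_subtractf)
    then show "2 * (chip_dist G x - chip_dist G (\<lambda>v. out_degree_vec G v - x v))
      = int (card (arcs G)) - 2 * chip_deg G x"
      using le[of x] le[of "\<lambda>v. out_degree_vec G v - x v"] by simp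
  qed
qed

section \<open>Balanced orders and bidirectedness\<close>

lemma chip_deg_later_in_degree:
  "chip_deg G (later_in_degree r) =
    (\<Sum>(v, w) \<in> verts G \<times> verts G. if r v < r w then mult w v else 0)"
  by (simp add: chip_deg_def later_in_degree_def sum.cartesian_product)

lemma balanced_if_bidirected:
  assumes bi: "bidirected G" and r: "inj_on r (verts G)"
  shows "2 * chip_deg G (later_in_degree r) = int (card (arcs G))"
proof -
  have "chip_deg G (later_in_degree r) =
      (\<Sum>v \<in> verts G. \<Sum>w \<in> verts G. if r v < r w then mult v w else 0)"
    unfolding chip_deg_def later_in_degree_def
    using bi by (intro sum.cong refl) (auto simp: bidirected_def)
  also have "\<dots> = chip_deg G (later_in_degree (\<lambda>w. - r w))"
    unfolding chip_deg_def later_in_degree_def by (subst sum.swap) simp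
  finally show ?thesis using chip_deg_later_in_degree_reverse[OF r] by simp
qed

lemma bidirected_if_balanced:
  assumes bal: "\<And>r. inj_on r (verts G) \<Longrightarrow>
      2 * chip_deg G (later_in_degree r) = int (card (arcs G))"
  shows "bidirected G"
  unfolding bidirected_def
proof (intro ballI)
  fix u v
  assume uv: "u \<in> verts G" "v \<in> verts G"
  show "arc_mult G u v = arc_mult G v u"
  proof (cases "u = v")
    case False
    obtain f :: "'a \<Rightarrow> nat" where f: "inj_on f (verts G)"
      using finite_imp_inj_to_nat_seg[OF finite_verts] by blast
    \<comment> \<open>All other vertices get rank at least 2, so \<open>u\<close> and \<open>v\<close> come first, and the two orders
      differ only in how they compare \<open>u\<close> with \<open>v\<close>.\<close>
    define order where "order a b w =
      (if w = u then a else if w = v then b else int (f w) + 2)" for a b :: int and w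
    let ?r = "order 0 1" and ?s = "order 1 0"
    have inj: "inj_on ?r (verts G)" "inj_on ?s (verts G)"
      using f by (auto simp: inj_on_def order_def)
    let ?P = "verts G \<times> verts G" and ?Q = "{(u, v), (v, u)}"
    define g where "g r = (\<lambda>(x, y). if r x < r y then mult y x else 0)" for r :: "'a \<Rightarrow> int"
    have deg: "chip_deg G (later_in_degree r) = sum (g r) (?P - ?Q) + sum (g r) ?Q" for r
      unfolding chip_deg_later_in_degree g_def
      using uv by (intro sum.subset_diff) auto
    have "sum (g ?r) (?P - ?Q) = sum (g ?s) (?P - ?Q)"
      by (intro sum.cong refl) (auto simp: g_def order_def split: if_splits)
    moreover have "sum (g ?r) ?Q = mult v u" "sum (g ?s) ?Q = mult u v"
      using False by (simp_all add: g_def order_def)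
    ultimately have "mult v u = mult u v"
      using deg[of ?r] deg[of ?s] bal[OF inj(1)] bal[OF inj(2)] by linarith
    then show ?thesis by simp
  qed simp
qed

end

theorem theorem5p6:
  fixes G :: "('a, 'b) pre_digraph"
  assumes "fin_digraph G"
    and "loopfree_digraph G"
    and "Digraph_Component.connected G"
    and "eulerian G"
  shows "natural_riemann_roch G \<longleftrightarrow> bidirected G"
proof -
  interpret fin_digraph G by fact
  interpret loopfree_digraph G by fact
  interpret connected_eulerian_digraph G
    by unfold_locales (use assms in auto)
  show ?thesis
    unfolding natural_riemann_roch_iff_balanced
    using balanced_if_bidirected bidirected_if_balanced by blast
qed

end
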